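(* Let $T$ be a tree of diameter $4$ with $n$ vertices, and let $\overline{d} = 2 - \frac{2}{n}$ (the average vertex degree of $T$). Then $m_T[0,\overline{d}) \geq \left\lceil \frac{n}{2} \right\rceil$, i.e., at least $\lceil n/2 \rceil$ of the Laplacian eigenvalues of $T$ (counted with multiplicity) lie in the interval $[0, 2 - \frac{2}{n})$.
   Context: For a graph $G$ with adjacency matrix $A$, the Laplacian matrix is $L = D - A$, where $D$ is the diagonal matrix of vertex degrees; the Laplacian eigenvalues of $G$ are the eigenvalues of $L$, counted with multiplicity. For a real interval $I$, $m_G(I)$ denotes the number of Laplacian eigenvalues of $G$ (counted with multiplicity) lying in $I$. The diameter of a tree is the maximum distance (number of edges on a shortest path) between two of its vertices. *)

theory Defs
  imports
    "Jordan_Normal_Form.Char_Poly"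
    "Graph_Theory.Graph_Theory"
    "HOL-Computational_Algebra.Polynomial"
begin

text \<open>
  Finite simple graphs are the locale \<^locale>\<open>graph\<close>: finite symmetric digraphs without loops and
  parallel arcs, each edge being represented by its two opposite arcs.

  The constant \<^const>\<open>tree\<close> of the library cannot be used for such graphs: there, the closed walk
  a, b, a along an edge and back is a cycle, so a symmetric digraph with an edge is never a
  \<^const>\<open>tree\<close>.  In a simple graph the cycles in the undirected sense are exactly those of length
  at least 3.
\<close>

definition undirected_tree :: "('a, 'b) pre_digraph \<Rightarrow> bool" where
  "undirected_tree G \<longleftrightarrow>
     graph G \<and> Digraph_Component.connected G \<and>
     \<not> (\<exists>p. pre_digraph.cycle G p \<and> length p \<ge> 3)"

text \<open>Only meaningful for \<open>u\<close> and \<open>v\<close> in the same component.\<close>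

definition vert_dist :: "('a, 'b) pre_digraph \<Rightarrow> 'a \<Rightarrow> 'a \<Rightarrow> nat" where
  "vert_dist G u v = (LEAST k. \<exists>p. pre_digraph.apath G u p v \<and> length p = k)"

definition diameter :: "('a, 'b) pre_digraph \<Rightarrow> nat" where
  "diameter G = Max {vert_dist G u v | u v. u \<in> verts G \<and> v \<in> verts G}"

text \<open>
  Matrices are indexed by natural numbers, so an enumeration of the vertices is fixed.
  Another enumeration conjugates the matrices below by a permutation matrix, which does not
  affect the characteristic polynomial.
\<close>

definition vert_list :: "('a, 'b) pre_digraph \<Rightarrow> 'a list" where
  "vert_list G = (SOME vs. distinct vs \<and> set vs = verts G)"

definition adjacency_matrix :: "('a, 'b) pre_digraph \<Rightarrow> real mat" where
  "adjacency_matrix G = (let vs = vert_list G; n = card (verts G) in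
     mat n n (\<lambda>(i, j). if (vs ! i, vs ! j) \<in> arcs_ends G then 1 else 0))"

definition degree_matrix :: "('a, 'b) pre_digraph \<Rightarrow> real mat" where
  "degree_matrix G = (let vs = vert_list G; n = card (verts G) in
     mat n n (\<lambda>(i, j). if i = j then real (out_degree G (vs ! i)) else 0))"

definition laplacian_matrix :: "('a, 'b) pre_digraph \<Rightarrow> real mat" where
  "laplacian_matrix G = degree_matrix G - adjacency_matrix G"

definition laplacian_eigenvalues :: "('a, 'b) pre_digraph \<Rightarrow> real multiset" where
  "laplacian_eigenvalues G = proots (char_poly (laplacian_matrix G))"

definition laplacian_count :: "('a, 'b) pre_digraph \<Rightarrow> real set \<Rightarrow> nat" where
  "laplacian_count G I = size {#x \<in># laplacian_eigenvalues G. x \<in> I#}"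

lemma vert_list:
  assumes "finite (verts G)"
  shows "distinct (vert_list G)" "set (vert_list G) = verts G"
    "length (vert_list G) = card (verts G)"
proof -
  have "\<exists>vs. distinct vs \<and> set vs = verts G"
    using finite_distinct_list[OF assms] by blast
  then have "distinct (vert_list G) \<and> set (vert_list G) = verts G"
    unfolding vert_list_def by (rule someI_ex)
  then show "distinct (vert_list G)" "set (vert_list G) = verts G"
    "length (vert_list G) = card (verts G)"
    using distinct_card by force+
qed

end

theory Submission
  imports Defs "Jordan_Normal_Form.Spectral_Radius"
begin

text \<open>
  Vectors that are pairwise orthogonal for the form of \<open>L - d\<close>, and on which it is negative, number
  at most the eigenvalues of the Laplacian \<open>L\<close> below \<open>d\<close> (Sylvester's law of inertia).
  A tree of diameter 4 has a center \<open>c\<close> such that every non-leaf other than \<open>c\<close> is adjacent to \<open>c\<close>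
  and carries a leaf.  The indicators of the leaves are such vectors, because leaves are pairwise
  non-adjacent and the form takes the value \<open>1 - d < 0\<close> on them; so the theorem follows if at least
  half of the vertices are leaves.  Otherwise the tree is a spider with legs of length 2, and the
  vector with value \<open>1\<close> at the center, \<open>d - 1\<close> at its neighbors and \<open>- 1\<close> at the leaves is one more
  such vector, with the value \<open>- d\<^sup>2 (2 - d) / 2\<close>.
\<close>

subsection \<open>Orthogonal diagonalization of real symmetric matrices\<close>

lemma cscalar_prod_mult_mat_vec:
  fixes A :: "'a :: conjugatable_field mat"
  assumes A: "A \<in> carrier_mat nr nc" and v: "v \<in> carrier_vec nc" and w: "w \<in> carrier_vec nr"
  shows "(A *\<^sub>v v) \<bullet>c w = v \<bullet>c (mat_adjoint A *\<^sub>v w)"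
proof -
  have "conjugate (mat_adjoint A *\<^sub>v w) = transpose_mat A *\<^sub>v conjugate w"
  proof (rule eq_vecI)
    fix i assume "i < dim_vec (transpose_mat A *\<^sub>v conjugate w)"
    then have i: "i < nc" using A by simp
    then have "col A i \<in> carrier_vec nr" using A by simp
    then show "conjugate (mat_adjoint A *\<^sub>v w) $ i = (transpose_mat A *\<^sub>v conjugate w) $ i"
      using i A w conjugate_conjugate_sprod[of "col A i" nr w] by (simp add: mat_adjoint_def)
  qed (use A in \<open>simp add: mat_adjoint_def\<close>)
  then have "v \<bullet>c (mat_adjoint A *\<^sub>v w) = (transpose_mat A *\<^sub>v conjugate w) \<bullet> v"
    using A v w by (simp add: comm_scalar_prod[of v nc])
  also have "\<dots> = conjugate w \<bullet> (A *\<^sub>v v)"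
    using w by (intro transpose_vec_mult_scalar[OF A v]) simp
  also have "\<dots> = (A *\<^sub>v v) \<bullet>c w"
    using A v w by (intro comm_scalar_prod[of _ nr]) auto
  finally show ?thesis ..
qed

lemma hermitian_eigenvalue_real:
  fixes A :: "complex mat"
  assumes A: "A \<in> carrier_mat n n" and hermitian: "mat_adjoint A = A" and ev: "eigenvalue A c"
  shows "c \<in> \<real>"
proof -
  obtain v where v: "v \<in> carrier_vec n" "v \<noteq> 0\<^sub>v n" and Av: "A *\<^sub>v v = c \<cdot>\<^sub>v v"
    using ev A by (auto simp: eigenvalue_def eigenvector_def)
  have "c * (v \<bullet>c v) = (A *\<^sub>v v) \<bullet>c v"
    using v by (simp add: Av)
  also have "\<dots> = v \<bullet>c (A *\<^sub>v v)"
    using cscalar_prod_mult_mat_vec[OF A v(1) v(1)] by (simp add: hermitian)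
  also have "\<dots> = cnj c * (v \<bullet>c v)"
    using v by (simp add: Av conjugate_smult_vec)
  finally show ?thesis
    using v by (simp add: Reals_cnj_iff)
qed

lemma symmetric_mat_index:
  assumes "A \<in> carrier_mat n n" "transpose_mat A = A" "i < n" "j < n"
  shows "A $$ (i, j) = A $$ (j, i)"
  using assms by (metis carrier_matD index_transpose_mat(1))

lemma symmetric_mat_eigenvalue_exists:
  fixes A :: "real mat"
  assumes A: "A \<in> carrier_mat n n" and sym: "transpose_mat A = A" and n: "n > 0"
  obtains e where "eigenvalue A e"
proof -
  let ?B = "map_mat complex_of_real A"
  have B: "?B \<in> carrier_mat n n" using A by simp
  have "mat_adjoint ?B = ?B"
    using A symmetric_mat_index[OF A sym]
    by (intro eq_matI) (auto simp: mat_adjoint_def mat_of_rows_index)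
  moreover obtain c where c: "eigenvalue ?B c"
    using spectrum_non_empty[OF B n] by (auto simp: spectrum_def)
  ultimately have "c \<in> \<real>" using hermitian_eigenvalue_real[OF B] by blast
  then obtain e where e: "c = complex_of_real e" by (auto elim: Reals_cases)
  have "poly (map_poly complex_of_real (char_poly A)) c = 0"
    using c B of_real_hom.char_poly_hom[OF A, where 'a = complex]
    by (simp add: eigenvalue_root_char_poly)
  then have "poly (char_poly A) e = 0"
    unfolding e by (simp add: of_real_hom.poly_map_poly)
  then show ?thesis using A that by (simp add: eigenvalue_root_char_poly)
qed

lemma symmetric_mat_unit_eigenvector:
  fixes A :: "real mat"
  assumes A: "A \<in> carrier_mat n n" and sym: "transpose_mat A = A" and n: "n > 0"
  obtains e v where "v \<in> carrier_vec n" "v \<bullet> v = 1" "A *\<^sub>v v = e \<cdot>\<^sub>v v"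
proof -
  obtain e where "eigenvalue A e" using symmetric_mat_eigenvalue_exists[OF A sym n] .
  then obtain x where x: "x \<in> carrier_vec n" "x \<noteq> 0\<^sub>v n" "A *\<^sub>v x = e \<cdot>\<^sub>v x"
    using A by (auto simp: eigenvalue_def eigenvector_def)
  let ?v = "(1 / sqrt (x \<bullet> x)) \<cdot>\<^sub>v x"
  have "x \<bullet> x > 0" using conjugate_square_greater_0_vec[OF x(1)] x(2) by simp
  then have "?v \<bullet> ?v = 1" using x by simp
  moreover have "A *\<^sub>v ?v = e \<cdot>\<^sub>v ?v"
    using A x by (simp add: mult_mat_vec smult_smult_assoc mult.commute)
  ultimately show ?thesis using that[of ?v e] x(1) by simp
qed

definition orthogonal_mat :: "nat \<Rightarrow> 'a :: semiring_1 mat \<Rightarrow> bool" where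
  "orthogonal_mat n P \<longleftrightarrow> P \<in> carrier_mat n n \<and> transpose_mat P * P = 1\<^sub>m n"

lemma orthogonal_matD:
  fixes P :: "'a :: field mat"
  assumes "orthogonal_mat n P"
  shows "P \<in> carrier_mat n n" "transpose_mat P * P = 1\<^sub>m n" "P * transpose_mat P = 1\<^sub>m n"
  using assms mat_mult_left_right_inverse[of "transpose_mat P" n P]
  by (auto simp: orthogonal_mat_def)

lemma orthogonal_mat_mult:
  fixes P Q :: "'a :: field mat"
  assumes P: "orthogonal_mat n P" and Q: "orthogonal_mat n Q"
  shows "orthogonal_mat n (P * Q)"
proof -
  note P' = orthogonal_matD[OF P] and Q' = orthogonal_matD[OF Q]
  have "transpose_mat (P * Q) * (P * Q) = transpose_mat Q * (transpose_mat P * P) * Q"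
    using P'(1) Q'(1) by (simp add: transpose_mult[of P n n Q n] assoc_mult_mat[of _ n n _ n _ n])
  then show ?thesis using P' Q' by (simp add: orthogonal_mat_def)
qed

lemma unit_vec_orthogonal_mat_completion:
  fixes v :: "real vec"
  assumes v: "v \<in> carrier_vec n" "v \<bullet> v = 1"
  obtains P where "orthogonal_mat n P" "col P 0 = v"
proof -
  interpret cof_vec_space n "TYPE(real)" .
  have v0: "v \<noteq> 0\<^sub>v n" using v by auto
  note basis = basis_completion[OF v(1) v0]
  define ws where "ws = gram_schmidt n (basis_completion v)"
  have ws: "set ws \<subseteq> carrier_vec n" "corthogonal ws" "length ws = n"
    using gram_schmidt_result[OF basis(2,4,5) ws_def] basis(6) by auto
  define P where "P = mat_of_cols n (map (\<lambda>w. (1 / sqrt (w \<bullet> w)) \<cdot>\<^sub>v w) ws)"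
  have ws_carrier: "ws ! i \<in> carrier_vec n" if "i < n" for i using that ws by auto
  have orthogonal: "ws ! i \<bullet> ws ! j = 0 \<longleftrightarrow> i \<noteq> j" if "i < n" "j < n" for i j
    using corthogonalD[OF ws(2), of i j] that ws(3) by simp
  have P: "P \<in> carrier_mat n n"
    by (simp add: P_def ws(3)[symmetric] mat_of_cols_def)
  have col_P: "col P i = (1 / sqrt (ws ! i \<bullet> ws ! i)) \<cdot>\<^sub>v ws ! i" if "i < n" for i
    using that ws ws_carrier by (simp add: P_def)
  have "transpose_mat P * P = 1\<^sub>m n"
  proof (rule eq_matI)
    fix i j assume "i < dim_row (1\<^sub>m n :: real mat)" "j < dim_col (1\<^sub>m n :: real mat)"
    then have ij: "i < n" "j < n" by auto
    have "(transpose_mat P * P) $$ (i, j)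
        = (1 / sqrt (ws ! i \<bullet> ws ! i)) * (1 / sqrt (ws ! j \<bullet> ws ! j)) * (ws ! i \<bullet> ws ! j)"
      using ij P ws_carrier
      by (simp add: col_P smult_scalar_prod_distrib[of _ n] scalar_prod_smult_distrib[of _ n])
    moreover have "0 \<le> ws ! i \<bullet> ws ! i" by (simp add: scalar_prod_def sum_nonneg)
    ultimately show "(transpose_mat P * P) $$ (i, j) = 1\<^sub>m n $$ (i, j)"
      using ij orthogonal[OF ij] orthogonal[OF ij(1) ij(1)] by auto
  qed (use P in auto)
  moreover have "n > 0" using v v0 by (intro gr0I) auto
  then have "ws ! 0 = v"
    using gram_schmidt_hd[OF v(1)] basis(6,7) ws(3)
    by (metis hd_conv_nth length_0_conv less_numeral_extra(3) list.collapse ws_def)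
  then have "col P 0 = v" using col_P[of 0] \<open>n > 0\<close> v by simp
  ultimately show ?thesis using that P by (simp add: orthogonal_mat_def)
qed

definition direct_sum_mat :: "'a :: zero mat \<Rightarrow> 'a mat \<Rightarrow> 'a mat" where
  "direct_sum_mat A B =
     four_block_mat A (0\<^sub>m (dim_row A) (dim_col B)) (0\<^sub>m (dim_row B) (dim_col A)) B"

lemma direct_sum_mat_carrier [simp]:
  "A \<in> carrier_mat nr nc \<Longrightarrow> B \<in> carrier_mat mr mc \<Longrightarrow>
    direct_sum_mat A B \<in> carrier_mat (nr + mr) (nc + mc)"
  by (simp add: direct_sum_mat_def)

lemma transpose_direct_sum_mat:
  "transpose_mat (direct_sum_mat A B) = direct_sum_mat (transpose_mat A) (transpose_mat B)"
  unfolding direct_sum_mat_def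
  by (subst transpose_four_block_mat[of _ "dim_row A" "dim_col A" _ "dim_col B" _ "dim_row B"]) auto

lemma direct_sum_mat_mult:
  fixes A B :: "'a :: semiring_0 mat"
  assumes "A \<in> carrier_mat nr n" "B \<in> carrier_mat mr m"
    and "C \<in> carrier_mat n nc" "D \<in> carrier_mat m mc"
  shows "direct_sum_mat A B * direct_sum_mat C D = direct_sum_mat (A * C) (B * D)"
  unfolding direct_sum_mat_def using assms
  by (subst mult_four_block_mat[of _ nr n _ m _ mr _ _ nc _ mc])
    (auto simp: left_mult_zero_mat[of _ _ nc] left_mult_zero_mat[of _ _ mc])

lemma direct_sum_mat_one: "direct_sum_mat (1\<^sub>m n) (1\<^sub>m m) = 1\<^sub>m (n + m)"
  by (simp add: direct_sum_mat_def)

lemma direct_sum_mat_diag: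
  "direct_sum_mat (mat_diag 1 (\<lambda>_. e)) (mat_diag m f) = mat_diag (Suc m) (case_nat e f)"
  by (rule eq_matI) (auto simp: direct_sum_mat_def mat_diag_def split: nat.split)

lemma direct_sum_mat_diagonalization:
  fixes Q :: "'a :: comm_semiring_1 mat"
  assumes Q: "Q \<in> carrier_mat m m"
  shows "direct_sum_mat (mat_diag 1 (\<lambda>_. e)) (Q * mat_diag m f * transpose_mat Q)
    = direct_sum_mat (1\<^sub>m 1) Q * mat_diag (Suc m) (case_nat e f)
        * transpose_mat (direct_sum_mat (1\<^sub>m 1) Q)"
proof -
  let ?E = "mat_diag 1 (\<lambda>_. e)" and ?D = "mat_diag m f"
  have QD: "Q * ?D \<in> carrier_mat m m" and Qt: "transpose_mat Q \<in> carrier_mat m m"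
    using Q by auto
  have "direct_sum_mat (1\<^sub>m 1) Q * mat_diag (Suc m) (case_nat e f)
      = direct_sum_mat (1\<^sub>m 1 * ?E) (Q * ?D)"
    unfolding direct_sum_mat_diag[symmetric]
    by (rule direct_sum_mat_mult[OF one_carrier_mat Q mat_diag_dim mat_diag_dim])
  moreover have "direct_sum_mat ?E (Q * ?D) * transpose_mat (direct_sum_mat (1\<^sub>m 1) Q)
      = direct_sum_mat (?E * 1\<^sub>m 1) (Q * ?D * transpose_mat Q)"
    unfolding transpose_direct_sum_mat transpose_one
    by (rule direct_sum_mat_mult[OF mat_diag_dim QD one_carrier_mat Qt])
  ultimately show ?thesis
    by (simp add: left_mult_one_mat[OF mat_diag_dim] right_mult_one_mat[OF mat_diag_dim])
qed

lemma orthogonal_mat_direct_sum_one: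
  fixes Q :: "'a :: field mat"
  assumes "orthogonal_mat m Q"
  shows "orthogonal_mat (Suc m) (direct_sum_mat (1\<^sub>m 1) Q)"
  using orthogonal_matD[OF assms] direct_sum_mat_carrier[of "1\<^sub>m 1" 1 1 Q m m]
  by (simp add: orthogonal_mat_def transpose_direct_sum_mat
      direct_sum_mat_mult[of _ 1 1 _ m m _ 1 _ m] direct_sum_mat_one)

lemma symmetric_mat_eq_direct_sum:
  fixes B :: "'a :: zero mat"
  assumes B: "B \<in> carrier_mat (Suc m) (Suc m)" and sym: "transpose_mat B = B"
    and col: "\<And>i. i < Suc m \<Longrightarrow> B $$ (i, 0) = (if i = 0 then e else 0)"
  obtains C where "C \<in> carrier_mat m m" "transpose_mat C = C"
    "B = direct_sum_mat (mat_diag 1 (\<lambda>_. e)) C"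
proof -
  define C where "C = mat m m (\<lambda>(i, j). B $$ (Suc i, Suc j))"
  note B_sym = symmetric_mat_index[OF B sym]
  have "B = direct_sum_mat (mat_diag 1 (\<lambda>_. e)) C"
    using B col B_sym[of 0] by (intro eq_matI) (auto simp: C_def direct_sum_mat_def mat_diag_def)
  moreover have "C \<in> carrier_mat m m" "transpose_mat C = C"
    by (auto simp: C_def intro!: eq_matI B_sym)
  ultimately show ?thesis using that by blast
qed

lemma symmetric_mat_deflation:
  fixes A :: "real mat"
  assumes A: "A \<in> carrier_mat (Suc m) (Suc m)" and sym: "transpose_mat A = A"
  obtains W e C where "orthogonal_mat (Suc m) W" "C \<in> carrier_mat m m" "transpose_mat C = C"
    "A = W * direct_sum_mat (mat_diag 1 (\<lambda>_. e)) C * transpose_mat W"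
proof -
  let ?n = "Suc m"
  obtain e v where v: "v \<in> carrier_vec ?n" "v \<bullet> v = 1" and Av: "A *\<^sub>v v = e \<cdot>\<^sub>v v"
    using symmetric_mat_unit_eigenvector[OF A sym] by blast
  obtain W where W: "orthogonal_mat ?n W" and col_W: "col W 0 = v"
    using unit_vec_orthogonal_mat_completion[OF v] .
  note W' = orthogonal_matD[OF W] and assoc = assoc_mult_mat[of _ ?n ?n _ ?n _ ?n]
  define B where "B = transpose_mat W * A * W"
  have B: "B \<in> carrier_mat ?n ?n" using W'(1) A by (simp add: B_def)
  have B_sym: "transpose_mat B = B"
    using W'(1) A sym by (simp add: B_def transpose_mult[of _ ?n ?n _ ?n] assoc)
  have B_col: "B $$ (i, 0) = (if i = 0 then e else 0)" if i: "i < ?n" for i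
  proof -
    have "B = transpose_mat W * (A * W)" using W'(1) A by (simp add: B_def assoc)
    then have "B $$ (i, 0) = row (transpose_mat W) i \<bullet> col (A * W) 0"
      using i W'(1) A by simp
    also have "\<dots> = col W i \<bullet> (A *\<^sub>v v)"
      using i W'(1) col_mult2[OF A W'(1) zero_less_Suc] col_W by simp
    also have "\<dots> = e * (col W i \<bullet> col W 0)"
      using i W'(1) v col_W by (simp add: Av)
    also have "\<dots> = (if i = 0 then e else 0)"
      using arg_cong[OF W'(2), of "\<lambda>M. M $$ (i, 0)"] i W'(1) by simp
    finally show ?thesis .
  qed
  obtain C where C: "C \<in> carrier_mat m m" "transpose_mat C = C"
    and B_C: "B = direct_sum_mat (mat_diag 1 (\<lambda>_. e)) C"
    using symmetric_mat_eq_direct_sum[OF B B_sym B_col] .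
  have "W * B * transpose_mat W = (W * transpose_mat W) * A * (W * transpose_mat W)"
    using W'(1) A by (simp add: B_def assoc)
  then have "A = W * B * transpose_mat W" using A W'(3) by simp
  then show ?thesis using that W C B_C by blast
qed

theorem symmetric_mat_orthogonal_diagonalization:
  fixes A :: "real mat"
  assumes "A \<in> carrier_mat n n" "transpose_mat A = A"
  obtains P f where "orthogonal_mat n P" "A = P * mat_diag n f * transpose_mat P"
  using assms
proof (induction n arbitrary: A thesis)
  case 0
  show ?case
    by (rule "0.prems"(1)[of "1\<^sub>m 0"]) (use "0.prems"(2) in \<open>auto simp: orthogonal_mat_def\<close>)
next
  case (Suc m)
  let ?n = "Suc m"
  obtain W e C where W: "orthogonal_mat ?n W" and C: "C \<in> carrier_mat m m" "transpose_mat C = C"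
    and A_W: "A = W * direct_sum_mat (mat_diag 1 (\<lambda>_. e)) C * transpose_mat W"
    using symmetric_mat_deflation[OF Suc.prems(2,3)] .
  obtain Q g where Q: "orthogonal_mat m Q" and C_Q: "C = Q * mat_diag m g * transpose_mat Q"
    using Suc.IH[OF _ C] .
  define R where "R = direct_sum_mat (1\<^sub>m 1) Q"
  define D where "D = mat_diag ?n (case_nat e g)"
  have R: "orthogonal_mat ?n R" unfolding R_def by (rule orthogonal_mat_direct_sum_one[OF Q])
  have carrier: "W \<in> carrier_mat ?n ?n" "R \<in> carrier_mat ?n ?n" "D \<in> carrier_mat ?n ?n"
    using orthogonal_matD(1)[OF W] orthogonal_matD(1)[OF R] by (auto simp: D_def)
  have "A = W * (R * D * transpose_mat R) * transpose_mat W"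
    unfolding A_W C_Q R_def D_def direct_sum_mat_diagonalization[OF orthogonal_matD(1)[OF Q]] ..
  also have "\<dots> = (W * R) * D * transpose_mat (W * R)"
    using carrier
    by (simp add: transpose_mult[of _ ?n ?n _ ?n] assoc_mult_mat[of _ ?n ?n _ ?n _ ?n])
  finally have "A = (W * R) * D * transpose_mat (W * R)" .
  then show ?case
    using Suc.prems(1) orthogonal_mat_mult[OF W R] by (simp add: D_def)
qed

subsection \<open>Counting eigenvalues below a threshold\<close>

lemma sum_eliminate_pivot:
  fixes b r y :: "'i \<Rightarrow> 'k :: field"
  assumes I: "finite I" "p \<in> I"
  defines "x \<equiv> y(p := - (\<Sum>i\<in>I - {p}. r i * y i) / r p)"
  shows "(\<Sum>i\<in>I. b i * x i) = (\<Sum>i\<in>I - {p}. (b i - b p * r i / r p) * y i)"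
proof -
  have "(\<Sum>i\<in>I. b i * x i) = b p * x p + (\<Sum>i\<in>I - {p}. b i * y i)"
    using I by (simp add: sum.remove[of I p] x_def)
  then show ?thesis
    by (simp add: x_def left_diff_distrib sum_subtractf sum_distrib_left sum_divide_distrib
        mult.assoc)
qed

lemma exists_nontrivial_solution:
  fixes a :: "'j \<Rightarrow> 'i \<Rightarrow> 'k :: field"
  assumes "finite J" "finite I" "card J < card I"
  obtains x where "\<exists>i\<in>I. x i \<noteq> 0" "\<And>j. j \<in> J \<Longrightarrow> (\<Sum>i\<in>I. a j i * x i) = 0"
  using assms
proof (induction J arbitrary: I a thesis rule: finite_induct)
  case empty
  then have "I \<noteq> {}" by auto
  then show ?case by (intro empty.prems(1)[of "\<lambda>_. 1"]) auto
next
  case (insert j J)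
  note finite_I = insert.prems(2) and card = insert.prems(3)
  show ?case
  proof (cases "\<forall>i\<in>I. a j i = 0")
    case True
    obtain x where x: "\<exists>i\<in>I. x i \<noteq> 0" "\<And>k. k \<in> J \<Longrightarrow> (\<Sum>i\<in>I. a k i * x i) = 0"
      using insert.IH[OF _ finite_I] card insert.hyps by auto
    have "(\<Sum>i\<in>I. a k i * x i) = 0" if "k \<in> insert j J" for k
      using that x(2) True by auto
    then show ?thesis by (rule insert.prems(1)[OF x(1)])
  next
    case False
    then obtain p where p: "p \<in> I" "a j p \<noteq> 0" by blast
    let ?b = "\<lambda>k i. a k i - a k p * a j i / a j p"
    have "card J < card (I - {p})" using card insert.hyps p(1) finite_I by simp
    then obtain y where y: "\<exists>i\<in>I - {p}. y i \<noteq> 0"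
      and reduced: "\<And>k. k \<in> J \<Longrightarrow> (\<Sum>i\<in>I - {p}. ?b k i * y i) = 0"
      using insert.IH[of "I - {p}" ?b] finite_I by auto
    define x where "x = y(p := - (\<Sum>i\<in>I - {p}. a j i * y i) / a j p)"
    have "(\<Sum>i\<in>I. a k i * x i) = (\<Sum>i\<in>I - {p}. ?b k i * y i)" for k
      unfolding x_def by (rule sum_eliminate_pivot[OF finite_I p(1)])
    then have "(\<Sum>i\<in>I. a k i * x i) = 0" if "k \<in> insert j J" for k
      using that reduced p(2) by (cases "k = j") auto
    moreover have "\<exists>i\<in>I. x i \<noteq> 0" using y by (auto simp: x_def)
    ultimately show ?thesis using insert.prems(1) by blast
  qed
qed

lemma sylvester_inertia:
  fixes f :: "'j \<Rightarrow> 'k :: linordered_field" and a :: "'j \<Rightarrow> 'i \<Rightarrow> 'k"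
  assumes J: "finite J" and I: "finite I"
    and orthogonal: "\<And>i i'. \<lbrakk>i \<in> I; i' \<in> I; i \<noteq> i'\<rbrakk> \<Longrightarrow> (\<Sum>j\<in>J. f j * a j i * a j i') = 0"
    and negative: "\<And>i. i \<in> I \<Longrightarrow> (\<Sum>j\<in>J. f j * (a j i)\<^sup>2) < 0"
  shows "card I \<le> card {j \<in> J. f j < 0}"
proof (rule ccontr)
  let ?q = "\<lambda>i i'. \<Sum>j\<in>J. f j * a j i * a j i'"
  assume "\<not> ?thesis"
  then obtain x where x: "\<exists>i\<in>I. x i \<noteq> 0"
    and kernel: "\<And>j. j \<in> {j \<in> J. f j < 0} \<Longrightarrow> (\<Sum>i\<in>I. a j i * x i) = 0"
    using exists_nontrivial_solution[of "{j \<in> J. f j < 0}" I a] I J by auto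
  have "(\<Sum>j\<in>J. f j * (\<Sum>i\<in>I. a j i * x i)\<^sup>2)
      = (\<Sum>j\<in>J. \<Sum>i\<in>I. \<Sum>i'\<in>I. x i * x i' * (f j * a j i * a j i'))"
    unfolding power2_eq_square sum_product by (simp add: sum_distrib_left mult_ac)
  also have "\<dots> = (\<Sum>i\<in>I. \<Sum>i'\<in>I. \<Sum>j\<in>J. x i * x i' * (f j * a j i * a j i'))"
    by (subst sum.swap) (intro sum.cong refl sum.swap)
  also have "\<dots> = (\<Sum>i\<in>I. \<Sum>i'\<in>I. x i * x i' * ?q i i')"
    by (simp add: sum_distrib_left)
  also have "\<dots> = (\<Sum>i\<in>I. \<Sum>i'\<in>I. if i' = i then (x i)\<^sup>2 * ?q i i else 0)"
    using orthogonal by (intro sum.cong) (auto simp: power2_eq_square)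
  also have "\<dots> = (\<Sum>i\<in>I. (x i)\<^sup>2 * ?q i i)" using I by simp
  also have "\<dots> < 0"
  proof -
    have q: "?q i i < 0" if "i \<in> I" for i
      using negative[OF that] by (simp add: power2_eq_square mult.assoc)
    obtain i where "i \<in> I" "x i \<noteq> 0" using x by blast
    then have "0 < (\<Sum>i\<in>I. (x i)\<^sup>2 * - ?q i i)"
      using I q
      by (intro sum_pos2[of I i] mult_pos_pos mult_nonneg_nonneg) (auto intro: less_imp_le)
    then show ?thesis by (simp add: sum_negf)
  qed
  finally have "(\<Sum>j\<in>J. f j * (\<Sum>i\<in>I. a j i * x i)\<^sup>2) < 0" .
  moreover have "0 \<le> f j * (\<Sum>i\<in>I. a j i * x i)\<^sup>2" if "j \<in> J" for j
    using kernel[of j] that by (cases "f j < 0") auto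
  ultimately show False using sum_nonneg[of J] by (meson not_less)
qed

lemma proots_prod_list_linear:
  "proots (\<Prod>a\<leftarrow>as. [:- a, 1:]) = mset (as :: 'a :: idom list)"
proof -
  have "0 \<notin> set (map (\<lambda>a. [:- a, 1:]) as)" by auto
  from proots_prod_list[OF this] show ?thesis by (simp add: o_def)
qed

lemma proots_char_poly_orthogonal_diagonalization:
  fixes P :: "'a :: field mat"
  assumes P: "orthogonal_mat n P"
  shows "proots (char_poly (P * mat_diag n f * transpose_mat P)) = mset (map f [0..<n])"
proof -
  let ?A = "P * mat_diag n f * transpose_mat P" and ?D = "mat_diag n f"
  note P' = orthogonal_matD[OF P]
  have "similar_mat ?A ?D"
    using P' by (intro similar_matI[of _ _ P "transpose_mat P" n]) auto
  then have "char_poly ?A = char_poly ?D" by (rule char_poly_similar)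
  also have "\<dots> = (\<Prod>a\<leftarrow>diag_mat ?D. [:- a, 1:])"
    by (rule char_poly_upper_triangular[OF mat_diag_dim]) (auto simp: mat_diag_def)
  also have "diag_mat ?D = map f [0..<n]" by (auto simp: diag_mat_def mat_diag_def)
  finally show ?thesis by (simp only: proots_prod_list_linear)
qed

lemma scalar_prod_orthogonal_diagonalization:
  fixes P :: "'a :: field mat"
  assumes P: "orthogonal_mat n P" and x: "x \<in> carrier_vec n" and y: "y \<in> carrier_vec n"
  shows "x \<bullet> (P * mat_diag n f * transpose_mat P *\<^sub>v y)
    = (\<Sum>i<n. f i * (col P i \<bullet> x) * (col P i \<bullet> y))"
proof -
  note P' = orthogonal_matD[OF P]
  let ?D = "mat_diag n f"
  define u v where "u = transpose_mat P *\<^sub>v x" and "v = transpose_mat P *\<^sub>v y"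
  have v: "v \<in> carrier_vec n" using P'(1) y by (simp add: v_def)
  have Dv: "?D *\<^sub>v v \<in> carrier_vec n" by (rule mult_mat_vec_carrier[OF mat_diag_dim v])
  have "P * ?D * transpose_mat P *\<^sub>v y = P *\<^sub>v (?D *\<^sub>v v)"
    using P'(1) y by (simp add: v_def assoc_mult_mat_vec[of _ n n _ n])
  then have "x \<bullet> (P * ?D * transpose_mat P *\<^sub>v y) = u \<bullet> (?D *\<^sub>v v)"
    using transpose_vec_mult_scalar[OF P'(1) Dv x] by (simp add: u_def)
  also have "\<dots> = (\<Sum>i<n. u $ i * (f i * v $ i))"
  proof -
    have "(?D *\<^sub>v v) $ i = f i * v $ i" if "i < n" for i
      using that v
      by (simp add: mat_diag_def scalar_prod_def if_distrib[of "\<lambda>a. a * _"] cong: if_cong)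
    then show ?thesis by (simp add: scalar_prod_def mat_diag_def lessThan_atLeast0)
  qed
  also have "\<dots> = (\<Sum>i<n. f i * (col P i \<bullet> x) * (col P i \<bullet> y))"
    using P'(1) by (intro sum.cong) (auto simp: u_def v_def)
  finally show ?thesis .
qed

theorem card_le_eigenvalue_count:
  fixes A :: "real mat" and u :: "'i \<Rightarrow> real vec"
  assumes A: "A \<in> carrier_mat n n" and sym: "transpose_mat A = A"
    and I: "finite I" and u: "\<And>i. i \<in> I \<Longrightarrow> u i \<in> carrier_vec n"
    and orthogonal: "\<And>i j. \<lbrakk>i \<in> I; j \<in> I; i \<noteq> j\<rbrakk> \<Longrightarrow> u i \<bullet> (A *\<^sub>v u j) = d * (u i \<bullet> u j)"
    and negative: "\<And>i. i \<in> I \<Longrightarrow> u i \<bullet> (A *\<^sub>v u i) < d * (u i \<bullet> u i)"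
  shows "card I \<le> size {#e \<in># proots (char_poly A). e < d#}"
proof -
  obtain P f where P: "orthogonal_mat n P" and A_P: "A = P * mat_diag n f * transpose_mat P"
    using symmetric_mat_orthogonal_diagonalization[OF A sym] .
  let ?a = "\<lambda>k i. col P k \<bullet> u i"
  have "1\<^sub>m n = P * mat_diag n (\<lambda>_. 1) * transpose_mat P"
    using orthogonal_matD[OF P] by simp
  then have "u i \<bullet> u j = (\<Sum>k<n. ?a k i * ?a k j)" if "i \<in> I" "j \<in> I" for i j
    using scalar_prod_orthogonal_diagonalization[OF P u[OF that(1)] u[OF that(2)], of "\<lambda>_. 1"]
      u that by simp
  then have form: "(\<Sum>k<n. (f k - d) * ?a k i * ?a k j) = u i \<bullet> (A *\<^sub>v u j) - d * (u i \<bullet> u j)"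
    if "i \<in> I" "j \<in> I" for i j
    using that u
    by (simp add: A_P scalar_prod_orthogonal_diagonalization[OF P] left_diff_distrib sum_subtractf
        sum_distrib_left mult.assoc)
  have "card I \<le> card {k \<in> {..<n}. f k - d < 0}"
  proof (rule sylvester_inertia[OF _ I])
    show "(\<Sum>k<n. (f k - d) * ?a k i * ?a k j) = 0" if "i \<in> I" "j \<in> I" "i \<noteq> j" for i j
      using that by (simp add: form orthogonal)
    show "(\<Sum>k<n. (f k - d) * (?a k i)\<^sup>2) < 0" if "i \<in> I" for i
      using negative[OF that] form[OF that that] by (simp add: power2_eq_square mult.assoc)
  qed simp
  also have "\<dots> = size {#e \<in># mset (map f [0..<n]). e < d#}"
    unfolding mset_filter[symmetric] size_mset filter_map length_map length_filter_conv_card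
    by (intro arg_cong[of _ _ card]) auto
  finally show ?thesis
    by (simp only: A_P proots_char_poly_orthogonal_diagonalization[OF P])
qed

subsection \<open>The Laplacian as a quadratic form\<close>

definition neighbors :: "('a, 'b) pre_digraph \<Rightarrow> 'a \<Rightarrow> 'a set" where
  "neighbors G v = {w. (v, w) \<in> arcs_ends G}"

definition laplacian :: "('a, 'b) pre_digraph \<Rightarrow> ('a \<Rightarrow> real) \<Rightarrow> 'a \<Rightarrow> real" where
  "laplacian G g v = (\<Sum>w\<in>neighbors G v. g v - g w)"

definition shifted_laplacian_form ::
    "('a, 'b) pre_digraph \<Rightarrow> real \<Rightarrow> ('a \<Rightarrow> real) \<Rightarrow> ('a \<Rightarrow> real) \<Rightarrow> real" where
  "shifted_laplacian_form G d g h = (\<Sum>v\<in>verts G. g v * (laplacian G h v - d * h v))"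

context graph
begin

lemma neighbors_subset: "neighbors G v \<subseteq> verts G"
  by (auto simp: neighbors_def)

lemma finite_neighbors [simp]: "finite (neighbors G v)"
  using finite_subset[OF neighbors_subset finite_verts] .

lemma neighbors_sym: "w \<in> neighbors G v \<longleftrightarrow> v \<in> neighbors G w"
  using arcs_ends_symmetric sym_arcs by (auto simp: neighbors_def)

lemma not_self_neighbor: "v \<notin> neighbors G v"
  using adj_not_same by (auto simp: neighbors_def)

lemma arcs_ends_eq_Sigma_neighbors: "arcs_ends G = Sigma (verts G) (neighbors G)"
  by (auto simp: neighbors_def)

lemma out_degree_eq_card_neighbors: "out_degree G v = card (neighbors G v)"
proof -
  have "inj_on (head G) (out_arcs G v)"
    by (rule inj_onI) (auto intro: no_multi_arcs simp: arc_to_ends_def)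
  moreover have "head G ` out_arcs G v = neighbors G v"
    by (auto simp: neighbors_def arcs_ends_conv out_arcs_def image_iff)
  ultimately show ?thesis unfolding out_degree_def by (metis card_image)
qed

lemma dirichlet_form:
  "2 * (\<Sum>v\<in>verts G. g v * laplacian G h v) = (\<Sum>(v, w)\<in>arcs_ends G. (g v - g w) * (h v - h w))"
proof -
  have forward: "(\<Sum>v\<in>verts G. g v * laplacian G h v) = (\<Sum>(v, w)\<in>arcs_ends G. g v * (h v - h w))"
    unfolding arcs_ends_eq_Sigma_neighbors
    by (simp add: laplacian_def sum_distrib_left sum.Sigma)
  also have "\<dots> = (\<Sum>(v, w)\<in>arcs_ends G. g w * (h w - h v))"
    using arcs_ends_symmetric[OF sym_arcs]
    by (intro sum.reindex_bij_witness[of _ prod.swap prod.swap]) auto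
  finally have backward:
    "(\<Sum>v\<in>verts G. g v * laplacian G h v) = (\<Sum>(v, w)\<in>arcs_ends G. g w * (h w - h v))" .
  have "2 * (\<Sum>v\<in>verts G. g v * laplacian G h v)
      = (\<Sum>(v, w)\<in>arcs_ends G. g v * (h v - h w)) + (\<Sum>(v, w)\<in>arcs_ends G. g w * (h w - h v))"
    using forward backward by simp
  also have "\<dots> = (\<Sum>(v, w)\<in>arcs_ends G. (g v - g w) * (h v - h w))"
    by (simp add: sum.distrib[symmetric] case_prod_beta algebra_simps)
  finally show ?thesis .
qed

lemma laplacian_form_nonneg: "0 \<le> (\<Sum>v\<in>verts G. g v * laplacian G g v)"
proof -
  have "0 \<le> (\<Sum>(v, w)\<in>arcs_ends G. (g v - g w) * (g v - g w))" by (intro sum_nonneg) auto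
  then show ?thesis using dirichlet_form[of g g] by simp
qed

lemma shifted_laplacian_form_commute:
  "shifted_laplacian_form G d g h = shifted_laplacian_form G d h g"
proof -
  have "(\<Sum>v\<in>verts G. g v * laplacian G h v) = (\<Sum>v\<in>verts G. h v * laplacian G g v)"
    using dirichlet_form[of g h] dirichlet_form[of h g] by (simp add: mult.commute)
  then show ?thesis
    by (simp add: shifted_laplacian_form_def right_diff_distrib sum_subtractf mult_ac)
qed

lemma shifted_laplacian_form_indicator:
  assumes "l \<in> verts G"
  shows "shifted_laplacian_form G d (\<lambda>v. of_bool (v = l)) h = laplacian G h l - d * h l"
  using assms
  by (simp add: shifted_laplacian_form_def of_bool_def if_distrib[of "\<lambda>a. a * _"] cong: if_cong)

definition vec_of_fun :: "('a \<Rightarrow> real) \<Rightarrow> real vec" where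
  "vec_of_fun g = vec (card (verts G)) (\<lambda>i. g (vert_list G ! i))"

lemma vec_of_fun_carrier [simp]: "vec_of_fun g \<in> carrier_vec (card (verts G))"
  by (simp add: vec_of_fun_def)

lemma bij_betw_vert_list_nth: "bij_betw ((!) (vert_list G)) {..<card (verts G)} (verts G)"
  using vert_list[OF finite_verts] by (intro bij_betw_nth) auto

lemma sum_vert_list_nth: "(\<Sum>i<card (verts G). h (vert_list G ! i)) = (\<Sum>v\<in>verts G. h v)"
  by (rule sum.reindex_bij_betw[OF bij_betw_vert_list_nth])

lemma scalar_prod_vec_of_fun: "vec_of_fun g \<bullet> vec_of_fun h = (\<Sum>v\<in>verts G. g v * h v)"
  using sum_vert_list_nth[of "\<lambda>v. g v * h v"]
  by (simp add: vec_of_fun_def scalar_prod_def lessThan_atLeast0)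

lemma vec_of_fun_surj:
  assumes x: "x \<in> carrier_vec (card (verts G))"
  obtains g where "x = vec_of_fun g"
proof -
  let ?g = "\<lambda>v. x $ (the_inv_into {..<card (verts G)} ((!) (vert_list G)) v)"
  have "x = vec_of_fun ?g"
    using bij_betw_vert_list_nth x
    by (intro eq_vecI) (auto simp: vec_of_fun_def the_inv_into_f_f bij_betw_def)
  then show ?thesis by (rule that)
qed

lemma laplacian_matrix_carrier:
  "laplacian_matrix G \<in> carrier_mat (card (verts G)) (card (verts G))"
  by (simp add: laplacian_matrix_def degree_matrix_def adjacency_matrix_def Let_def
      minus_carrier_mat)

lemma laplacian_matrix_index:
  assumes "i < card (verts G)" "j < card (verts G)"
  defines "v \<equiv> vert_list G ! i" and "w \<equiv> vert_list G ! j"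
  shows "laplacian_matrix G $$ (i, j) =
    (if v = w then real (card (neighbors G v)) else 0) - of_bool (w \<in> neighbors G v)"
proof -
  have "v = w \<longleftrightarrow> i = j"
    using bij_betw_vert_list_nth assms by (auto simp: bij_betw_def inj_on_def)
  then show ?thesis
    using assms by (simp add: laplacian_matrix_def degree_matrix_def adjacency_matrix_def Let_def
        out_degree_eq_card_neighbors neighbors_def)
qed

lemma transpose_laplacian_matrix: "transpose_mat (laplacian_matrix G) = laplacian_matrix G"
proof (rule eq_matI)
  fix i j assume "i < dim_row (laplacian_matrix G)" "j < dim_col (laplacian_matrix G)"
  then show "transpose_mat (laplacian_matrix G) $$ (i, j) = laplacian_matrix G $$ (i, j)"
    using laplacian_matrix_carrier neighbors_sym[of "vert_list G ! i" "vert_list G ! j"]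
    by (auto simp: laplacian_matrix_index)
qed (use laplacian_matrix_carrier in auto)

lemma laplacian_matrix_mult_vec_of_fun:
  "laplacian_matrix G *\<^sub>v vec_of_fun g = vec_of_fun (laplacian G g)"
proof (rule eq_vecI)
  let ?n = "card (verts G)"
  fix i assume "i < dim_vec (vec_of_fun (laplacian G g))"
  then have i: "i < ?n" by (simp add: vec_of_fun_def)
  define v where "v = vert_list G ! i"
  have v: "v \<in> verts G" using i bij_betw_vert_list_nth by (auto simp: v_def bij_betw_def)
  let ?N = "neighbors G v"
  have "(laplacian_matrix G *\<^sub>v vec_of_fun g) $ i
      = (\<Sum>j<?n. laplacian_matrix G $$ (i, j) * g (vert_list G ! j))"
    using i laplacian_matrix_carrier
    by (auto simp: vec_of_fun_def scalar_prod_def lessThan_atLeast0 intro!: sum.cong)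
  also have "\<dots> = (\<Sum>j<?n. (\<lambda>w. (if v = w then real (card ?N) * g w else 0)
      - (if w \<in> ?N then g w else 0)) (vert_list G ! j))"
    using i by (intro sum.cong) (auto simp: laplacian_matrix_index v_def left_diff_distrib)
  also have "\<dots> = (\<Sum>w\<in>verts G. (if v = w then real (card ?N) * g w else 0)
      - (if w \<in> ?N then g w else 0))"
    by (rule sum_vert_list_nth)
  also have "\<dots> = real (card ?N) * g v - (\<Sum>w\<in>?N. g w)"
    using neighbors_subset[of v] v
    by (simp add: sum_subtractf sum.inter_restrict[symmetric] Int_absorb1)
  also have "\<dots> = laplacian G g v" by (simp add: laplacian_def sum_subtractf)
  finally show "(laplacian_matrix G *\<^sub>v vec_of_fun g) $ i = vec_of_fun (laplacian G g) $ i"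
    using i by (simp add: vec_of_fun_def v_def)
qed (use laplacian_matrix_carrier in \<open>simp add: vec_of_fun_def\<close>)

lemma laplacian_eigenvalue_nonneg:
  assumes "e \<in># laplacian_eigenvalues G"
  shows "0 \<le> e"
proof -
  let ?L = "laplacian_matrix G"
  have "char_poly ?L \<noteq> 0" using degree_monic_char_poly[OF laplacian_matrix_carrier] by auto
  then have "eigenvalue ?L e"
    using assms laplacian_matrix_carrier
    by (simp add: laplacian_eigenvalues_def eigenvalue_root_char_poly)
  then obtain x where x: "x \<in> carrier_vec (card (verts G))" "x \<noteq> 0\<^sub>v (card (verts G))"
    and Lx: "?L *\<^sub>v x = e \<cdot>\<^sub>v x"
    using laplacian_matrix_carrier by (auto simp: eigenvalue_def eigenvector_def)
  obtain g where g: "x = vec_of_fun g" using vec_of_fun_surj[OF x(1)] .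
  have "0 \<le> x \<bullet> (?L *\<^sub>v x)"
    unfolding g laplacian_matrix_mult_vec_of_fun scalar_prod_vec_of_fun
    by (rule laplacian_form_nonneg)
  then have "0 \<le> e * (x \<bullet> x)" using x by (simp add: Lx)
  moreover have "x \<bullet> x > 0" using conjugate_square_greater_0_vec[OF x(1)] x(2) by simp
  ultimately show ?thesis by (simp add: zero_le_mult_iff)
qed

theorem card_le_laplacian_count:
  assumes F: "finite F" and orthogonal: "pairwise (\<lambda>g h. shifted_laplacian_form G d g h = 0) F"
    and negative: "\<And>g. g \<in> F \<Longrightarrow> shifted_laplacian_form G d g g < 0"
  shows "card F \<le> laplacian_count G {0..<d}"
proof -
  let ?L = "laplacian_matrix G"
  have form: "shifted_laplacian_form G d g h
      = vec_of_fun g \<bullet> (?L *\<^sub>v vec_of_fun h) - d * (vec_of_fun g \<bullet> vec_of_fun h)" for g h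
    unfolding laplacian_matrix_mult_vec_of_fun scalar_prod_vec_of_fun
    by (simp add: shifted_laplacian_form_def right_diff_distrib sum_subtractf sum_distrib_left
        mult_ac)
  have "card F \<le> size {#e \<in># proots (char_poly ?L). e < d#}"
  proof (rule card_le_eigenvalue_count[OF laplacian_matrix_carrier transpose_laplacian_matrix F])
    show "vec_of_fun g \<bullet> (?L *\<^sub>v vec_of_fun h) = d * (vec_of_fun g \<bullet> vec_of_fun h)"
      if "g \<in> F" "h \<in> F" "g \<noteq> h" for g h
      using orthogonal that by (simp add: pairwise_def form)
    show "vec_of_fun g \<bullet> (?L *\<^sub>v vec_of_fun g) < d * (vec_of_fun g \<bullet> vec_of_fun g)"
      if "g \<in> F" for g
      using negative[OF that] by (simp add: form)
  qed simp
  also have "{#e \<in># proots (char_poly ?L). e < d#} = {#e \<in># proots (char_poly ?L). e \<in> {0..<d}#}"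
    using laplacian_eigenvalue_nonneg
    by (intro filter_mset_cong) (auto simp: laplacian_eigenvalues_def)
  finally show ?thesis by (simp add: laplacian_count_def laplacian_eigenvalues_def)
qed

end

subsection \<open>Leaves\<close>

definition leaves :: "('a, 'b) pre_digraph \<Rightarrow> 'a set" where
  "leaves G = {v \<in> verts G. card (neighbors G v) = 1}"

context graph
begin

definition attachment :: "'a \<Rightarrow> 'a" where
  "attachment l = the_elem (neighbors G l)"

lemma finite_leaves [simp]: "finite (leaves G)"
  by (simp add: leaves_def)

lemma neighbors_leaf:
  assumes "l \<in> leaves G"
  shows "neighbors G l = {attachment l}"
proof -
  obtain v where "neighbors G l = {v}" using assms by (auto simp: leaves_def card_1_singleton_iff)
  then show ?thesis by (simp add: attachment_def)
qed

lemma neighbors_eq_singletonD: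
  assumes "neighbors G l = {v}"
  shows "l \<in> leaves G" "attachment l = v"
proof -
  have "l \<in> neighbors G v" using assms neighbors_sym[of l v] by simp
  then show "l \<in> leaves G" using assms neighbors_subset by (auto simp: leaves_def)
  show "attachment l = v" using assms by (simp add: attachment_def)
qed

end

subsection \<open>Paths in forests and trees\<close>

context wf_digraph
begin

lemma vwalk_imp_awalk:
  assumes "vwalk xs G"
  shows "\<exists>p. awalk (hd xs) p (last xs) \<and> awalk_verts (hd xs) p = xs"
  using assms
proof (induction rule: vwalk_induct)
  case (Base u)
  then show ?case by (intro exI[of _ "[]"]) (simp add: awalk_Nil_iff)
next
  case (Cons u v es)
  then obtain p where p: "awalk v p (last (v # es))" "awalk_verts v p = v # es" by auto
  obtain e where e: "e \<in> arcs G" "tail G e = u" "head G e = v"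
    using Cons.hyps by auto
  then have "awalk u (e # p) (last (v # es))" using p by (simp add: awalk_Cons_iff)
  moreover have "awalk_verts u (e # p) = u # v # es" using e p by simp
  ultimately show ?case by (intro exI[of _ "e # p"]) simp
qed

lemma ex_apath_length_iff_ex_vpath:
  "(\<exists>p. apath u p v \<and> length p = k)
    \<longleftrightarrow> (\<exists>xs. vpath xs G \<and> hd xs = u \<and> last xs = v \<and> length xs = Suc k)"
proof
  assume "\<exists>p. apath u p v \<and> length p = k"
  then obtain p where p: "awalk u p v" "distinct (awalk_verts u p)" "length p = k"
    by (auto simp: apath_def)
  then have "vpath (awalk_verts u p) G" by (simp add: vpath_def awalk_imp_vwalk)
  moreover have "hd (awalk_verts u p) = u" "last (awalk_verts u p) = v" using p(1) by auto
  ultimately show "\<exists>xs. vpath xs G \<and> hd xs = u \<and> last xs = v \<and> length xs = Suc k"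
    using p(3) by (intro exI[of _ "awalk_verts u p"]) (simp add: length_awalk_verts)
next
  assume "\<exists>xs. vpath xs G \<and> hd xs = u \<and> last xs = v \<and> length xs = Suc k"
  then obtain xs where xs: "vwalk xs G" "distinct xs" "hd xs = u" "last xs = v" "length xs = Suc k"
    by (auto simp: vpath_def)
  then obtain p where "awalk u p v" "awalk_verts u p = xs" using vwalk_imp_awalk by blast
  then show "\<exists>p. apath u p v \<and> length p = k"
    using xs length_awalk_verts[of u p] by (intro exI[of _ p]) (simp add: apath_def)
qed

lemma vpath_Cons_Cons:
  "vpath (x # y # xs) G \<longleftrightarrow> (x, y) \<in> arcs_ends G \<and> x \<notin> set (y # xs) \<and> vpath (y # xs) G"
  by (auto simp: vpath_def)

lemma vpath_appendD1: "vpath (xs @ ys) G \<Longrightarrow> xs \<noteq> [] \<Longrightarrow> vpath xs G"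
  by (auto simp: vpath_def dest: vwalkI_append_l)

lemma vpath_appendD2: "vpath (xs @ ys) G \<Longrightarrow> ys \<noteq> [] \<Longrightarrow> vpath ys G"
  by (auto simp: vpath_def dest: vwalkI_append_r)

end

lemma (in sym_digraph) vpath_rev: "vpath xs G \<Longrightarrow> vpath (rev xs) G"
  using vwalk_rev_ex[OF sym_arcs] by (auto simp: vpath_def)

locale undirected_forest = graph G for G :: "('a, 'b) pre_digraph" +
  assumes cycle_short: "cycle p \<Longrightarrow> length p < 3"
begin

lemma no_closed_vpath:
  assumes xs: "vpath xs G" "length xs \<ge> 3"
  shows "(last xs, hd xs) \<notin> arcs_ends G"
proof
  assume "(last xs, hd xs) \<in> arcs_ends G"
  then have "vwalk (last xs # xs) G" using xs by (cases xs) (auto simp: vpath_def)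
  from vwalk_imp_awalk[OF this] obtain p
    where p: "awalk (last xs) p (last xs)" "awalk_verts (last xs) p = last xs # xs"
    using xs by auto
  have len: "length p = length xs" using p(2) length_awalk_verts[of "last xs" p] by simp
  then have "cycle p"
    unfolding cycle_def using p xs by (intro exI[of _ "last xs"]) (auto simp: vpath_def)
  then show False using cycle_short[of p] len xs by simp
qed

lemma vpath_extend:
  assumes xs: "vpath (x # y # xs) G" and zx: "(z, x) \<in> arcs_ends G" and zy: "z \<noteq> y"
  shows "vpath (z # x # y # xs) G"
proof -
  have "z \<noteq> x" using zx adj_not_same by blast
  moreover have "z \<notin> set xs"
  proof
    assume "z \<in> set xs"
    then obtain as bs where "xs = as @ z # bs" by (auto simp: in_set_conv_decomp)
    then have "vpath (x # y # as @ [z]) G" using vpath_appendD1[of "x # y # as @ [z]" bs] xs by simp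
    then show False using no_closed_vpath[of "x # y # as @ [z]"] zx by simp
  qed
  ultimately show ?thesis using xs zx zy by (simp add: vpath_Cons_Cons)
qed

lemma vpath_append_overlap:
  assumes "vpath (xs @ [u, v]) G" "vpath (u # v # ys) G"
  shows "vpath (xs @ u # v # ys) G"
  using assms(1)
proof (induction xs)
  case Nil
  then show ?case using assms(2) by simp
next
  case (Cons x xs)
  obtain y z zs where xs: "xs @ [u, v] = y # z # zs"
    by (cases xs; cases "tl xs") auto
  then have glued: "xs @ u # v # ys = y # z # zs @ ys"
    by (metis append.assoc append_Cons append_Nil)
  have path: "vpath (x # y # z # zs) G" using Cons.prems by (simp add: xs)
  then have "vpath (y # z # zs @ ys) G" using Cons.IH by (simp add: xs glued vpath_Cons_Cons)
  then have "vpath (x # y # z # zs @ ys) G"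
    using path by (intro vpath_extend) (auto simp: vpath_Cons_Cons)
  then show ?case by (simp add: glued)
qed

lemma vpath_join:
  assumes as: "vpath (c # a # as) G" and bs: "vpath (c # b # bs) G" and "a \<noteq> b"
  shows "vpath (rev as @ a # c # b # bs) G"
proof (rule vpath_append_overlap)
  show "vpath (rev as @ [a, c]) G" using vpath_rev[OF as] by simp
  have "(a, c) \<in> arcs_ends G"
    using as arcs_ends_symmetric[OF sym_arcs] by (simp add: vpath_Cons_Cons)
  then show "vpath (a # c # b # bs) G" using vpath_extend[OF bs] \<open>a \<noteq> b\<close> by simp
qed

lemma vpath_unique:
  assumes "vpath xs G" "vpath ys G" "hd xs = hd ys" "last xs = last ys"
  shows "xs = ys"
  using assms
proof (induction xs arbitrary: ys)
  case Nil
  then show ?case by (auto simp: vpath_def)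
next
  case (Cons x xs)
  obtain ys' where ys: "ys = x # ys'"
    using Cons.prems by (cases ys) (auto simp: vpath_def)
  show ?case
  proof (cases "xs = [] \<or> ys' = []")
    case True
    then show ?thesis
      using Cons.prems ys
      by (cases xs rule: rev_cases; cases ys' rule: rev_cases) (auto simp: vpath_def)
  next
    case False
    then obtain a as b bs where ab: "xs = a # as" "ys' = b # bs" by (meson neq_Nil_conv)
    have "a = b"
    proof (rule ccontr)
      assume "a \<noteq> b"
      then have "vpath (rev as @ a # x # b # bs) G"
        using vpath_join Cons.prems(1,2) ys ab by simp
      then have "set (a # as) \<inter> set (b # bs) = {}" by (auto simp: vpath_def)
      moreover have "last (a # as) = last (b # bs)" using Cons.prems(4) ys ab by simp
      ultimately show False using last_in_set[of "a # as"] last_in_set[of "b # bs"]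
        by (metis disjoint_iff list.distinct(1))
    qed
    then show ?thesis using Cons.IH[of ys'] Cons.prems ys ab by (auto simp: vpath_Cons_Cons)
  qed
qed

lemma vert_dist_vpath:
  assumes xs: "vpath xs G"
  shows "Suc (vert_dist G (hd xs) (last xs)) = length xs"
proof -
  obtain k where k: "length xs = Suc k" using xs by (cases xs) (auto simp: vpath_def)
  have "vert_dist G (hd xs) (last xs) = k"
    unfolding vert_dist_def ex_apath_length_iff_ex_vpath
  proof (rule Least_equality)
    show "\<exists>ys. vpath ys G \<and> hd ys = hd xs \<and> last ys = last xs \<and> length ys = Suc k"
      using xs k by blast
  next
    fix l assume "\<exists>ys. vpath ys G \<and> hd ys = hd xs \<and> last ys = last xs \<and> length ys = Suc l"
    then obtain ys where "vpath ys G" "hd ys = hd xs" "last ys = last xs" "length ys = Suc l"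
      by blast
    then show "k \<le> l" using vpath_unique[OF _ xs, of ys] k by simp
  qed
  then show ?thesis using k by simp
qed

end

lemma (in fin_digraph) finite_vert_dists:
  "finite {vert_dist G u v | u v. u \<in> verts G \<and> v \<in> verts G}"
  by (rule finite_subset[of _ "(\<lambda>(u, v). vert_dist G u v) ` (verts G \<times> verts G)"]) auto

locale undirected_tree_graph = undirected_forest +
  assumes connected: "Digraph_Component.connected G"
begin

lemma vpath_exists:
  assumes "u \<in> verts G" "v \<in> verts G"
  obtains xs where "vpath xs G" "hd xs = u" "last xs = v"
proof -
  have "strongly_connected G"
    using symmetric_connected_imp_strongly_connected[OF sym_arcs connected] .
  then have "u \<rightarrow>\<^sup>*\<^bsub>G\<^esub> v" using assms by auto
  then show ?thesis using that by (auto simp: reachable_vpath_conv)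
qed

lemma length_vpath_le_diameter:
  assumes "vpath xs G"
  shows "length xs \<le> Suc (diameter G)"
proof -
  have "hd xs \<in> verts G" "last xs \<in> verts G"
    using assms by (auto simp: vpath_def vwalk_def)
  then have "vert_dist G (hd xs) (last xs) \<le> diameter G"
    unfolding diameter_def by (intro Max_ge finite_vert_dists) auto
  then show ?thesis using vert_dist_vpath[OF assms] by simp
qed

lemma diameter_vpath_exists:
  obtains xs where "vpath xs G" "length xs = Suc (diameter G)"
proof -
  obtain r where "r \<in> verts G"
    using connected by (auto simp: connected_def strongly_connected_def)
  then have "{vert_dist G u v | u v. u \<in> verts G \<and> v \<in> verts G} \<noteq> {}" by blast
  then have "diameter G \<in> {vert_dist G u v | u v. u \<in> verts G \<and> v \<in> verts G}"
    unfolding diameter_def by (rule Max_in[OF finite_vert_dists])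
  then obtain u v where uv: "u \<in> verts G" "v \<in> verts G" "diameter G = vert_dist G u v" by auto
  obtain xs where "vpath xs G" "hd xs = u" "last xs = v"
    using vpath_exists[OF uv(1,2)] .
  then show ?thesis using that[of xs] vert_dist_vpath[of xs] uv(3) by simp
qed

lemma diameter_less_card_verts: "diameter G < card (verts G)"
proof -
  obtain xs where xs: "vpath xs G" "length xs = Suc (diameter G)"
    using diameter_vpath_exists .
  then have "card (set xs) \<le> card (verts G)"
    by (intro card_mono) (auto simp: vpath_def vwalk_def)
  then show ?thesis using xs by (simp add: vpath_def distinct_card)
qed

lemma diameter_vpath_halves:
  assumes diam: "diameter G = 2 * k" and "0 < k"
  obtains c a as b bs where "vpath (c # a # as) G" "vpath (c # b # bs) G" "a \<noteq> b"
    "length (a # as) = k" "length (b # bs) = k"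
proof -
  obtain xs where xs: "vpath xs G" "length xs = Suc (2 * k)"
    using diameter_vpath_exists diam by metis
  then obtain ls c rs where xs_eq: "xs = ls @ c # rs" and len: "length ls = k" "length rs = k"
    using id_take_nth_drop[of k xs]
    by (intro that[of "take k xs" "xs ! k" "drop (Suc k) xs"]) auto
  obtain as a where as: "ls = as @ [a]" using len(1) \<open>0 < k\<close> by (cases ls rule: rev_cases) auto
  obtain b bs where bs: "rs = b # bs" using len(2) \<open>0 < k\<close> by (cases rs) auto
  have path: "vpath (as @ a # c # b # bs) G" using xs(1) by (simp add: xs_eq as bs)
  show ?thesis
  proof (rule that)
    show "vpath (c # a # rev as) G"
      using vpath_rev[OF path] vpath_appendD2[of "rev bs @ [b]" "c # a # rev as"] by simp
    show "vpath (c # b # bs) G"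
      using path vpath_appendD2[of "as @ [a]" "c # b # bs"] by simp
    show "a \<noteq> b" using path by (auto simp: vpath_def)
  qed (use len in \<open>simp_all add: as bs\<close>)
qed

text \<open>The center is the midpoint of a longest path.\<close>

lemma center_exists:
  assumes diam: "diameter G = 2 * k" and "0 < k"
  obtains c where "c \<in> verts G" "c \<notin> leaves G"
    "\<And>ys. vpath (c # ys) G \<Longrightarrow> length ys \<le> k"
proof -
  obtain c a as b bs where left: "vpath (c # a # as) G" "length (a # as) = k"
    and right: "vpath (c # b # bs) G" "length (b # bs) = k" and ab: "a \<noteq> b"
    using diameter_vpath_halves[OF assms] .
  have bound: "length (y # zs) \<le> k"
    if "vpath (c # t # ts) G" "length (t # ts) = k" "t \<noteq> y" "vpath (c # y # zs) G" for t ts y zs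
    using length_vpath_le_diameter[OF vpath_join[OF that(1,4,3)]] that(2) diam by simp
  have "length ys \<le> k" if ys: "vpath (c # ys) G" for ys
  proof (cases ys)
    case (Cons y zs)
    then show ?thesis
      using bound[OF left _ ys[unfolded Cons]] bound[OF right _ ys[unfolded Cons]] ab
      by (cases "a = y") auto
  qed simp
  moreover have "a \<in> neighbors G c" "b \<in> neighbors G c"
    using left(1) right(1) by (auto simp: vpath_Cons_Cons neighbors_def)
  then have "c \<notin> leaves G"
    using ab by (auto simp: leaves_def card_1_singleton_iff)
  moreover have "c \<in> verts G"
    using left(1) by (auto simp: vpath_Cons_Cons)
  ultimately show ?thesis using that by blast
qed

end

subsection \<open>Trees of radius two\<close>

locale radius_two_tree = undirected_tree_graph +
  fixes c
  assumes center_in_verts: "c \<in> verts G" and center_not_leaf: "c \<notin> leaves G"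
    and length_vpath_center: "vpath (c # xs) G \<Longrightarrow> length xs \<le> 2"
begin

definition internal :: "'a set" where
  "internal = verts G - leaves G - {c}"

lemma finite_internal [simp]: "finite internal"
  by (simp add: internal_def)

lemma neighbors_vpath_end:
  assumes path: "vpath [c, u, v] G"
  shows "neighbors G v = {u}"
proof -
  have rev: "vpath [v, u, c] G" using vpath_rev[OF path] by simp
  have "w = u" if w: "w \<in> neighbors G v" for w
  proof (rule ccontr)
    assume "w \<noteq> u"
    then have "vpath [w, v, u, c] G"
      using vpath_extend[OF rev] w neighbors_sym[of w v] by (simp add: neighbors_def)
    from vpath_rev[OF this] have "vpath (c # [u, v, w]) G" by simp
    from length_vpath_center[OF this] show False by simp
  qed
  moreover have "u \<in> neighbors G v" using rev by (simp add: vpath_Cons_Cons neighbors_def)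
  ultimately show ?thesis by blast
qed

lemma vertex_cases:
  assumes "v \<in> verts G" "v \<noteq> c"
  obtains (adjacent) "v \<in> neighbors G c" | (distance_two) u where "vpath [c, u, v] G"
proof -
  obtain xs where xs: "vpath (c # xs) G" "last (c # xs) = v"
    using vpath_exists[OF center_in_verts assms(1)] by (metis list.collapse vpath_def vwalk_def)
  have "xs \<noteq> []" using xs assms(2) by auto
  moreover have "length xs \<le> 2" using length_vpath_center[OF xs(1)] .
  ultimately consider "xs = [v]" | u where "xs = [u, v]"
    using xs(2) by (cases xs; cases "tl xs") auto
  then show ?thesis
    using xs(1) that by cases (auto simp: vpath_Cons_Cons neighbors_def)
qed

lemma neighbors_neighbor_of_center:
  assumes "v \<in> neighbors G c" "w \<in> neighbors G v" "w \<noteq> c"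
  shows "neighbors G w = {v}"
proof (rule neighbors_vpath_end)
  show "vpath [c, v, w] G"
    using assms not_self_neighbor by (auto simp: vpath_def neighbors_def)
qed

lemma internal_adjacent_center:
  assumes "v \<in> internal"
  shows "v \<in> neighbors G c"
proof -
  have v: "v \<in> verts G" "v \<noteq> c" "v \<notin> leaves G" using assms by (auto simp: internal_def)
  show ?thesis
    using v(1,2)
  proof (cases rule: vertex_cases)
    case (distance_two u)
    then have "v \<in> leaves G" using neighbors_eq_singletonD neighbors_vpath_end by blast
    then show ?thesis using v(3) by contradiction
  qed
qed

lemma attachment_not_leaf:
  assumes l: "l \<in> leaves G"
  shows "attachment l \<notin> leaves G"
proof -
  have "l \<in> verts G" "l \<noteq> c" using l center_not_leaf by (auto simp: leaves_def)
  then show ?thesis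
  proof (cases rule: vertex_cases)
    case adjacent
    then have "attachment l = c" using neighbors_sym[of l c] neighbors_leaf[OF l] by auto
    then show ?thesis using center_not_leaf by simp
  next
    case (distance_two u)
    then have "attachment l = u" using neighbors_vpath_end neighbors_eq_singletonD by blast
    moreover have "{c, l} \<subseteq> neighbors G u"
      using distance_two neighbors_sym[of c u] by (auto simp: vpath_Cons_Cons neighbors_def)
    ultimately show ?thesis using \<open>l \<noteq> c\<close> neighbors_leaf[of u] by auto
  qed
qed

lemma internal_subset_attachment_leaves: "internal \<subseteq> attachment ` leaves G"
proof
  fix v assume v: "v \<in> internal"
  have c_adj: "c \<in> neighbors G v"
    using internal_adjacent_center[OF v] neighbors_sym[of v c] by simp
  have "neighbors G v \<noteq> {c}" using v neighbors_eq_singletonD(1) by (auto simp: internal_def)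
  then obtain l where l: "l \<in> neighbors G v" "l \<noteq> c" using c_adj by blast
  have "neighbors G l = {v}"
    using neighbors_neighbor_of_center[OF internal_adjacent_center[OF v] l] .
  then show "v \<in> attachment ` leaves G" using neighbors_eq_singletonD by blast
qed

lemma card_internal_le_card_leaves: "card internal \<le> card (leaves G)"
  using surj_card_le[OF finite_leaves internal_subset_attachment_leaves] .

lemma verts_eq: "verts G = insert c (internal \<union> leaves G)"
  using center_in_verts by (auto simp: internal_def leaves_def)

lemma sum_verts: "(\<Sum>v\<in>verts G. h v) = h c + (\<Sum>v\<in>internal. h v) + (\<Sum>v\<in>leaves G. h v)"
  for h :: "'a \<Rightarrow> real"
proof -
  have "c \<notin> internal \<union> leaves G" "internal \<inter> leaves G = {}"
    using center_not_leaf by (auto simp: internal_def)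
  then show ?thesis unfolding verts_eq by (simp add: sum.union_disjoint)
qed

lemma card_verts: "card (verts G) = 1 + card internal + card (leaves G)"
  using sum_verts[of "\<lambda>_. 1"] by (simp flip: of_nat_eq_iff[where 'a = real])

definition leaf_indicators :: "('a \<Rightarrow> real) set" where
  "leaf_indicators = (\<lambda>l v. of_bool (v = l)) ` leaves G"

lemma finite_leaf_indicators: "finite leaf_indicators"
  by (simp add: leaf_indicators_def)

lemma card_leaf_indicators: "card leaf_indicators = card (leaves G)"
  unfolding leaf_indicators_def
proof (intro card_image inj_onI)
  fix l l' :: 'a assume "(\<lambda>v. of_bool (v = l) :: real) = (\<lambda>v. of_bool (v = l'))"
  from fun_cong[OF this, of l] show "l = l'" by simp
qed

lemma shifted_laplacian_form_leaf_indicators: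
  assumes l: "l \<in> leaves G" and l': "l' \<in> leaves G"
  shows "shifted_laplacian_form G d (\<lambda>v. of_bool (v = l)) (\<lambda>v. of_bool (v = l'))
    = (if l = l' then 1 - d else 0)"
proof -
  have "attachment l \<noteq> l'" using attachment_not_leaf[OF l] l' by auto
  then have "laplacian G (\<lambda>v. of_bool (v = l')) l = of_bool (l = l')"
    by (simp add: laplacian_def neighbors_leaf[OF l])
  then show ?thesis using l by (simp add: shifted_laplacian_form_indicator leaves_def)
qed

lemma pairwise_leaf_indicators:
  "pairwise (\<lambda>g h. shifted_laplacian_form G d g h = 0) leaf_indicators"
  by (auto simp: leaf_indicators_def pairwise_def shifted_laplacian_form_leaf_indicators)

lemma leaf_indicator_negative:
  assumes "1 < d" "g \<in> leaf_indicators"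
  shows "shifted_laplacian_form G d g g < 0"
  using assms by (auto simp: leaf_indicators_def shifted_laplacian_form_leaf_indicators)

lemma card_leaves_le_laplacian_count:
  assumes "1 < d"
  shows "card (leaves G) \<le> laplacian_count G {0..<d}"
  using card_le_laplacian_count[OF finite_leaf_indicators pairwise_leaf_indicators
      leaf_indicator_negative[OF assms]] by (simp add: card_leaf_indicators)

end

text \<open>Equality forces every internal vertex to carry exactly one leaf, and the center none.\<close>

locale spider_tree = radius_two_tree +
  assumes card_internal: "card internal = card (leaves G)"
begin

lemma attachment_image: "attachment ` leaves G = internal"
  using internal_subset_attachment_leaves card_image_le[OF finite_leaves, of attachment]
  by (intro card_seteq[symmetric]) (auto simp: card_internal)

lemma inj_on_attachment: "inj_on attachment (leaves G)"
  by (rule eq_card_imp_inj_on) (simp_all add: attachment_image card_internal)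

lemma neighbors_center: "neighbors G c = internal"
proof
  show "internal \<subseteq> neighbors G c" using internal_adjacent_center by blast
  show "neighbors G c \<subseteq> internal"
  proof
    fix v assume v: "v \<in> neighbors G c"
    have "v \<notin> leaves G"
    proof
      assume leaf: "v \<in> leaves G"
      then have "attachment v = c" using neighbors_leaf v neighbors_sym[of v c] by auto
      then have "c \<in> internal" using leaf attachment_image by auto
      then show False by (simp add: internal_def)
    qed
    then show "v \<in> internal"
      using v neighbors_subset not_self_neighbor by (auto simp: internal_def)
  qed
qed

lemma neighbors_internal:
  assumes v: "v \<in> internal"
  obtains l where "l \<in> leaves G" "neighbors G v = {c, l}"
proof -
  have "v \<in> attachment ` leaves G" using v by (simp add: attachment_image)
  then obtain l where l: "l \<in> leaves G" "attachment l = v" by blast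
  have "w = l" if "w \<in> neighbors G v" "w \<noteq> c" for w
  proof -
    have "neighbors G w = {v}"
      using neighbors_neighbor_of_center[OF internal_adjacent_center[OF v] that] .
    then have "w \<in> leaves G" "attachment w = attachment l"
      using neighbors_eq_singletonD[of w v] l(2) by auto
    then show ?thesis using inj_onD[OF inj_on_attachment _ _ l(1)] by simp
  qed
  moreover have "c \<in> neighbors G v" "l \<in> neighbors G v"
    using internal_adjacent_center[OF v] neighbors_leaf[OF l(1)] l(2)
      neighbors_sym[of c v] neighbors_sym[of l v] by auto
  ultimately have "neighbors G v = {c, l}" by blast
  then show ?thesis using that l(1) by blast
qed

text \<open>
  This vector satisfies the eigenvalue equation for \<open>d\<close> at every leaf, which makes it orthogonal
  to the leaf indicators with respect to the form of \<open>L - d\<close>.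
\<close>

definition level_vector :: "real \<Rightarrow> 'a \<Rightarrow> real" where
  "level_vector d v = (if v = c then 1 else if v \<in> leaves G then - 1 else d - 1)"

lemma level_vector_simps [simp]:
  "level_vector d c = 1"
  "l \<in> leaves G \<Longrightarrow> level_vector d l = - 1"
  "v \<in> internal \<Longrightarrow> level_vector d v = d - 1"
  using center_not_leaf by (auto simp: level_vector_def internal_def)

lemma laplacian_level_vector_leaf:
  assumes l: "l \<in> leaves G"
  shows "laplacian G (level_vector d) l = d * level_vector d l"
proof -
  have "attachment l \<in> internal" using l attachment_image by blast
  then show ?thesis using l by (simp add: laplacian_def neighbors_leaf)
qed

lemma laplacian_level_vector_internal:
  assumes v: "v \<in> internal"
  shows "laplacian G (level_vector d) v = 2 * (d - 1)"
proof -
  obtain l where "l \<in> leaves G" "neighbors G v = {c, l}" using neighbors_internal[OF v] .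
  moreover from this have "c \<noteq> l" using center_not_leaf by auto
  ultimately show ?thesis using v by (simp add: laplacian_def)
qed

lemma laplacian_level_vector_center:
  "laplacian G (level_vector d) c = real (card internal) * (2 - d)"
  by (simp add: laplacian_def neighbors_center)

lemma level_vector_negative:
  assumes d: "d = 2 - 2 / real (card (verts G))" and "1 < d"
  shows "shifted_laplacian_form G d (level_vector d) (level_vector d) < 0"
proof -
  let ?r = "real (card internal)"
  have card_eq: "real (card (verts G)) = 2 * ?r + 1" using card_verts by (simp add: card_internal)
  have r_eq: "?r * (2 - d) = d / 2" by (simp add: d card_eq field_simps)
  have "shifted_laplacian_form G d (level_vector d) (level_vector d)
      = ?r * (2 - d) - d + ?r * ((d - 1) * (2 * (d - 1) - d * (d - 1)))"
    unfolding shifted_laplacian_form_def sum_verts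
    by (simp add: laplacian_level_vector_leaf laplacian_level_vector_internal
        laplacian_level_vector_center)
  also have "\<dots> = ?r * (2 - d) * (1 + (d - 1)\<^sup>2) - d"
    by (simp add: power2_eq_square algebra_simps)
  also have "\<dots> = - (d\<^sup>2 * (2 - d) / 2)"
    unfolding r_eq by (simp add: power2_eq_square field_simps)
  also have "\<dots> < 0"
  proof -
    have "d < 2" using d card_eq by simp
    then show ?thesis using \<open>1 < d\<close> by simp
  qed
  finally show ?thesis .
qed

lemma Suc_card_leaves_le_laplacian_count:
  assumes d: "d = 2 - 2 / real (card (verts G))" and "1 < d"
  shows "Suc (card (leaves G)) \<le> laplacian_count G {0..<d}"
proof -
  let ?w = "level_vector d" and ?F = leaf_indicators
  have "g c = 0" if "g \<in> ?F" for g
    using that center_not_leaf by (auto simp: leaf_indicators_def)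
  then have "?w \<notin> ?F" using level_vector_simps(1)[of d] by fastforce
  then have "Suc (card (leaves G)) = card (insert ?w ?F)"
    by (simp add: finite_leaf_indicators card_leaf_indicators)
  also have "\<dots> \<le> laplacian_count G {0..<d}"
  proof (rule card_le_laplacian_count)
    have "shifted_laplacian_form G d g ?w = 0" if "g \<in> ?F" for g
      using that laplacian_level_vector_leaf
      by (auto simp: leaf_indicators_def leaves_def shifted_laplacian_form_indicator)
    then show "pairwise (\<lambda>g h. shifted_laplacian_form G d g h = 0) (insert ?w ?F)"
      using pairwise_leaf_indicators shifted_laplacian_form_commute by (simp add: pairwise_insert)
    show "shifted_laplacian_form G d g g < 0" if "g \<in> insert ?w ?F" for g
      using that level_vector_negative[OF assms] leaf_indicator_negative[OF \<open>1 < d\<close>] by auto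
  qed (simp add: finite_leaf_indicators)
  finally show ?thesis .
qed

end

lemma (in radius_two_tree) card_verts_le_twice_laplacian_count:
  assumes n: "2 < card (verts G)" and d: "d = 2 - 2 / real (card (verts G))"
  shows "card (verts G) \<le> 2 * laplacian_count G {0..<d}"
proof -
  have d_gt_1: "1 < d" using n by (simp add: d field_simps)
  show ?thesis
  proof (cases "card internal = card (leaves G)")
    case True
    then interpret spider_tree G c by unfold_locales
    show ?thesis
      using Suc_card_leaves_le_laplacian_count[OF d d_gt_1] card_verts card_internal by simp
  next
    case False
    then show ?thesis
      using card_leaves_le_laplacian_count[OF d_gt_1] card_verts card_internal_le_card_leaves
      by simp
  qed
qed

lemma undirected_tree_iff: "undirected_tree G \<longleftrightarrow> undirected_tree_graph G"
  by (auto simp: undirected_tree_def undirected_tree_graph_def undirected_tree_graph_axioms_def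
      undirected_forest_def undirected_forest_axioms_def not_le[symmetric])

theorem theorem10:
  fixes T :: "('a, 'b) pre_digraph" and n :: nat and d :: real
  assumes "undirected_tree T"
    and "diameter T = 4"
    and "n = card (verts T)"
    and "d = 2 - 2 / real n"
  shows "int (laplacian_count T {0..<d}) \<ge> \<lceil>real n / 2\<rceil>"
proof -
  interpret undirected_tree_graph T using assms(1) by (simp add: undirected_tree_iff)
  have diam: "diameter T = 2 * 2" using assms(2) by simp
  obtain c where "c \<in> verts T" "c \<notin> leaves T" "\<And>xs. vpath (c # xs) T \<Longrightarrow> length xs \<le> 2"
    using center_exists[OF diam pos2] by blast
  then interpret radius_two_tree T c by unfold_locales
  have "2 < card (verts T)" using diameter_less_card_verts assms(2) by simp
  then have "n \<le> 2 * laplacian_count T {0..<d}"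
    using card_verts_le_twice_laplacian_count assms(3,4) by simp
  then show ?thesis by (simp add: ceiling_le_iff)
qed

end
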